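(* Let $p > 1$, $t \in [0,1]$, and let $\mu = \mu_1 \times \cdots \times \mu_n$ be a product measure on $\mathbb{R}^n$, where, for each $i = 1,\dots,n,$ $\mu_i$ is a measure on $\mathbb{R}$ having a quasi-concave density with maximum at the origin. Let $f,g,h \colon \mathbb{R}^n\to \mathbb{R}_+$ be a triple of measurable functions, with $f,g$ weakly unconditional and positively decreasing, that satisfy the condition $$h\big((1-t)^{1/p}(1-\lambda)^{(p-1)/p}x + t^{1/p}\lambda^{(p-1)/p}y\big) \geq f(x)^{(1-t)^{1/p}(1-\lambda)^{(p-1)/p}}\,g(y)^{t^{1/p}\lambda^{(p-1)/p}}$$ for every $x \in \mathrm{supp}(f)$, $y \in \mathrm{supp}(g)$, and every $0 < \lambda < 1$. Then $$\int_{\mathbb{R}^n} h\, d\mu \geq \sup_{0 < \lambda < 1}\left\{\left[\left(\frac{1-t}{1-\lambda}\right)^{1-\lambda} \left(\frac{t}{\lambda}\right)^{\lambda}\right]^{\frac{n}{p}}\left(\int_{\mathbb{R}^n} f^{\left(\frac{1-t}{1-\lambda}\right)^{\frac{1}{p}}} d\mu \right)^{1-\lambda}\left(\int_{\mathbb{R}^n}g^{\left(\frac{t}{\lambda}\right)^{\frac{1}{p}}} d\mu \right)^{\lambda} \right\}.$$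
   Context: $\mathbb{R}_+=[0,\infty)$; $\mathrm{supp}(f)=\{x\colon f(x)>0\}$. A function $f\colon\mathbb{R}^n\to\mathbb{R}_+$ is weakly unconditional if $f(\varepsilon_1x_1,\dots,\varepsilon_nx_n)\ge f(x_1,\dots,x_n)$ for every $x\in\mathbb{R}^n$ and every $(\varepsilon_1,\dots,\varepsilon_n)\in\{0,1\}^n$. It is positively decreasing if for every $x\in\mathbb{R}^n$ the function $r\mapsto f(rx)$ is decreasing (non-increasing) on $[0,\infty)$. A function $\phi\colon\mathbb{R}\to\mathbb{R}_+$ is quasi-concave if $\phi((1-t)x+ty)\ge\min\{\phi(x),\phi(y)\}$ whenever $\phi(x)\phi(y)>0$ and $t\in[0,1]$. *)

theory Defs
  imports "HOL-Analysis.Analysis"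
begin

definition fun_supp :: "('a \<Rightarrow> real) \<Rightarrow> 'a set" where
  "fun_supp f = {x. f x > 0}"

definition weakly_unconditional :: "(real ^ 'n \<Rightarrow> real) \<Rightarrow> bool" where
  "weakly_unconditional f \<longleftrightarrow>
     (\<forall>x. \<forall>\<epsilon> :: 'n \<Rightarrow> real. (\<forall>i. \<epsilon> i \<in> {0, 1}) \<longrightarrow> f (\<chi> i. \<epsilon> i * x $ i) \<ge> f x)"

definition positively_decreasing :: "(real ^ 'n \<Rightarrow> real) \<Rightarrow> bool" where
  "positively_decreasing f \<longleftrightarrow> (\<forall>x. antimono_on {0..} (\<lambda>r. f (r *\<^sub>R x)))"

definition quasi_concave :: "(real \<Rightarrow> real) \<Rightarrow> bool" where
  "quasi_concave \<phi> \<longleftrightarrow>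
     (\<forall>x y. \<forall>t\<in>{0..1}. \<phi> x * \<phi> y > 0 \<longrightarrow> \<phi> ((1 - t) * x + t * y) \<ge> min (\<phi> x) (\<phi> y))"

definition has_quasi_concave_density_max_at_0 :: "real measure \<Rightarrow> bool" where
  "has_quasi_concave_density_max_at_0 M \<longleftrightarrow>
     (\<exists>\<phi> :: real \<Rightarrow> real. \<phi> \<in> borel_measurable borel \<and> (\<forall>x. \<phi> x \<ge> 0) \<and> quasi_concave \<phi> \<and>
        (\<forall>x. \<phi> x \<le> \<phi> 0) \<and> M = density lborel (\<lambda>x. ennreal (\<phi> x)))"

text \<open>The product of the measures \<open>M i\<close>, transported from functions to vectors. It is completed so
  that every Lebesgue measurable function is measurable with respect to it when the \<open>M i\<close> have
  densities; completing does not change the value of any \<open>nn_integral\<close>.\<close>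

definition product_measure :: "('n::finite \<Rightarrow> real measure) \<Rightarrow> (real ^ 'n) measure" where
  "product_measure M = completion (distr (Pi\<^sub>M UNIV M) borel (\<lambda>f. \<chi> i. f i))"

text \<open>Powers of extended nonnegative reals. Only meant for exponents \<open>a > 0\<close>, where
  \<open>\<infinity>\<close> to the power \<open>a\<close> is \<open>\<infinity>\<close> and \<open>0\<close> to the power \<open>a\<close> is \<open>0\<close>.\<close>

definition ennpowr :: "ennreal \<Rightarrow> real \<Rightarrow> ennreal" where
  "ennpowr x a = (if x = \<infinity> then \<infinity> else ennreal (enn2real x powr a))"

end

theory Submission
  imports Defs
begin

text \<open>Put \<open>\<alpha> = ((1 - t) / (1 - l))\<^bsup>1/p\<^esup>\<close> and \<open>\<beta> = (t / l)\<^bsup>1/p\<^esup>\<close>. The coefficients in the hypothesis are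
  \<open>a = (1 - l) \<alpha>\<close> and \<open>b = l \<beta>\<close>, so \<open>F = f\<^sup>\<alpha>\<close>, \<open>G = g\<^sup>\<beta>\<close> and \<open>H = h\<close> satisfy
  \<open>H (a x + b y) \<ge> F(x)\<^bsup>1-l\<^esup> G(y)\<^sup>l\<close>, and the claim is a Prekopa-Leindler inequality with the extra factor
  \<open>(\<alpha>\<^bsup>1-l\<^esup> \<beta>\<^sup>l)\<^sup>n\<close>. For Lebesgue measure that factor comes from a change of variables. For the measures
  considered here it comes from the weak unconditionality of \<open>f\<close> and \<open>g\<close> and from \<open>a + b \<le> 1\<close>, which is
  Hoelder's inequality (\<open>holder_coefficients_le_1\<close>).

  On the line the key is a linear Brunn-Minkowski inequality, \<open>\<mu> (a A + b B) \<ge> a \<mu> A + b \<mu> B\<close> whenever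
  \<open>0 \<in> A\<close> and \<open>0 \<in> B\<close> (\<open>brunn_minkowski_quasi_concave_density\<close>). The superlevel sets of the density are
  intervals containing \<open>0\<close>, and because \<open>a + b \<le> 1\<close> such an interval \<open>L\<close> satisfies
  \<open>a (A \<inter> L) + b (B \<inter> L) \<subseteq> (a A + b B) \<inter> L\<close>; so the inequality reduces to the one for Lebesgue measure on
  each level. If \<open>F\<close> and \<open>G\<close> have their maxima at \<open>0\<close>, divide them by these maxima and apply the set
  inequality to superlevel sets. The result, \<open>\<integral> H \<ge> (1 - l) (\<alpha> \<integral> F) + l (\<beta> \<integral> G)\<close> for the normalised
  functions, implies the multiplicative form by the inequality of arithmetic and geometric means
  (\<open>prekopa_leindler_real\<close>).

  In several variables one integrates the coordinates out one at a time (\<open>prekopa_leindler_PiM\<close>). Weak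
  unconditionality passes to sections, and it makes the partial integrals of \<open>F\<close> and \<open>G\<close> maximal where
  the remaining coordinate is \<open>0\<close>, as the one-dimensional inequality requires.

  Fubini's theorem for every section needs Borel functions, whereas \<open>f\<close>, \<open>g\<close> and \<open>h\<close> are only Lebesgue
  measurable. So \<open>F\<close> and \<open>G\<close> are first replaced by smaller Borel functions that agree with them almost
  everywhere and still increase when coordinates are set to \<open>0\<close>
  (\<open>borel_minorant_increasing_under_zero_out\<close>), and \<open>H\<close> by a larger one.\<close>

section \<open>Powers of extended nonnegative reals\<close>

lemma ennpowr_top [simp]: "ennpowr top a = top"
  by (simp add: ennpowr_def)

lemma ennpowr_ennreal: "x \<ge> 0 \<Longrightarrow> ennpowr (ennreal x) a = ennreal (x powr a)"
  by (simp add: ennpowr_def)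

lemma ennpowr_0 [simp]: "ennpowr 0 a = 0"
  by (simp add: ennpowr_def)

lemma ennpowr_mono:
  assumes "0 \<le> a" "x \<le> y"
  shows "ennpowr x a \<le> ennpowr y a"
  using assms by (cases x; cases y) (auto simp: ennpowr_ennreal top_unique intro!: ennreal_leI powr_mono2)

lemma ennpowr_ennpowr_inverse:
  assumes "a > 0"
  shows "ennpowr (ennpowr x (1 / a)) a = x" "ennpowr (ennpowr x a) (1 / a) = x"
  using assms by (cases x; simp add: ennpowr_ennreal powr_powr)+

text \<open>For \<open>a > 0\<close> the map \<open>x \<mapsto> x\<^sup>a\<close> is an order isomorphism of \<open>[0, \<infinity>]\<close> with inverse
  \<open>x \<mapsto> x\<^bsup>1/a\<^esup>\<close>, and order isomorphisms preserve suprema. This gives monotone convergence for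
  powers of integrals without a discussion of continuity at infinity.\<close>

lemma ennpowr_SUP:
  assumes "a > 0"
  shows "ennpowr (SUP i\<in>I. X i) a = (SUP i\<in>I. ennpowr (X i) a)"
proof (rule antisym)
  let ?S = "SUP i\<in>I. ennpowr (X i) a"
  have "X i \<le> ennpowr ?S (1 / a)" if "i \<in> I" for i
  proof -
    have "X i = ennpowr (ennpowr (X i) a) (1 / a)"
      using assms by (simp add: ennpowr_ennpowr_inverse)
    also have "\<dots> \<le> ennpowr ?S (1 / a)"
      using assms that by (intro ennpowr_mono SUP_upper) auto
    finally show ?thesis .
  qed
  then have "(SUP i\<in>I. X i) \<le> ennpowr ?S (1 / a)"
    by (rule SUP_least)
  then have "ennpowr (SUP i\<in>I. X i) a \<le> ennpowr (ennpowr ?S (1 / a)) a"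
    using assms by (intro ennpowr_mono) auto
  then show "ennpowr (SUP i\<in>I. X i) a \<le> ?S"
    using assms by (simp add: ennpowr_ennpowr_inverse)
next
  show "(SUP i\<in>I. ennpowr (X i) a) \<le> ennpowr (SUP i\<in>I. X i) a"
    using assms by (intro SUP_least ennpowr_mono SUP_upper) auto
qed

lemma ennpowr_cmult:
  assumes "c > 0"
  shows "ennpowr (ennreal c * x) a = ennreal (c powr a) * ennpowr x a"
  using assms
  by (cases x) (auto simp: ennpowr_ennreal ennreal_mult_top powr_mult simp flip: ennreal_mult)

lemma ennpowr_weighted_AM_GM:
  assumes "0 < l" "l < 1"
  shows "ennpowr x (1 - l) * ennpowr y l \<le> ennreal (1 - l) * x + ennreal l * y"
proof (cases "x = top \<or> y = top")
  case True
  then show ?thesis using assms by (auto simp: ennreal_mult_top)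
next
  case False
  then obtain r s where rs: "x = ennreal r" "r \<ge> 0" "y = ennreal s" "s \<ge> 0"
    by (metis ennreal_cases infinity_ennreal_def)
  have "r powr (1 - l) * s powr l \<le> (1 - l) * r + l * s"
    using assms rs Youngs_inequality_0[of "1 - l" l r s] by (cases "r = 0 \<or> s = 0") auto
  then show ?thesis
    using assms rs by (simp add: ennpowr_ennreal ennreal_leI flip: ennreal_mult ennreal_plus)
qed

section \<open>The Brunn-Minkowski inequality on the line\<close>

text \<open>The sets \<open>A \<inter> {..a}\<close> with \<open>a \<in> A\<close> exhaust \<open>A\<close> up to small measure: below a cutoff \<open>n\<close> some
  \<open>a \<in> A\<close> lies within \<open>e\<close> of the supremum of \<open>A \<inter> {..n}\<close>. That the cut points belong to \<open>A\<close> itself is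
  what the Brunn-Minkowski argument needs.\<close>

lemma emeasure_le_SUP_initial_segments:
  fixes A :: "real set"
  assumes [measurable]: "A \<in> sets borel" and "A \<noteq> {}"
  shows "emeasure lborel A \<le> (SUP a\<in>A. emeasure lborel (A \<inter> {..a}))" (is "_ \<le> ?S")
proof -
  obtain a0 where a0: "a0 \<in> A" using assms by auto
  have "emeasure lborel (A \<inter> {..real n}) \<le> ?S" for n :: nat
  proof (cases "A \<inter> {..real n} = {}")
    case False
    define s where "s = Sup (A \<inter> {..real n})"
    have bdd: "bdd_above (A \<inter> {..real n})" by auto
    show ?thesis
    proof (rule ennreal_le_epsilon)
      fix e :: real assume "e > 0"
      then obtain a where a: "a \<in> A" "a \<le> real n" "s - e < a"
        using less_cSupD[of "A \<inter> {..real n}" "s - e"] False s_def by auto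
      have "A \<inter> {..real n} \<subseteq> (A \<inter> {..a}) \<union> {s - e<..s}"
        using cSup_upper[OF _ bdd] a by (force simp: s_def)
      then have "emeasure lborel (A \<inter> {..real n})
          \<le> emeasure lborel ((A \<inter> {..a}) \<union> {s - e<..s})"
        by (intro emeasure_mono) auto
      also have "\<dots> \<le> emeasure lborel (A \<inter> {..a}) + emeasure lborel {s - e<..s}"
        by (intro emeasure_subadditive) auto
      also have "\<dots> \<le> ?S + ennreal e"
        using a \<open>e > 0\<close> by (intro add_mono SUP_upper) auto
      finally show "emeasure lborel (A \<inter> {..real n}) \<le> ?S + ennreal e" .
    qed
  qed simp
  then have "(SUP n::nat. emeasure lborel (A \<inter> {..real n})) \<le> ?S"
    by (intro SUP_least) auto
  moreover have "(SUP n::nat. emeasure lborel (A \<inter> {..real n}))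
      = emeasure lborel (\<Union>n::nat. A \<inter> {..real n})"
    by (intro SUP_emeasure_incseq) (auto simp: incseq_def)
  moreover have "(\<Union>n::nat. A \<inter> {..real n}) = A"
    using real_arch_simple by auto
  ultimately show ?thesis by simp
qed

lemma emeasure_lborel_translate:
  fixes A :: "real set"
  assumes [measurable]: "A \<in> sets borel"
  shows "emeasure lborel {x. x - c \<in> A} = emeasure lborel A"
proof -
  have "emeasure lborel A = emeasure (distr lborel borel ((+) (- c))) A"
    by (simp add: lborel_distr_plus)
  also have "\<dots> = emeasure lborel {x. x - c \<in> A}"
    by (subst emeasure_distr) (auto simp: vimage_def)
  finally show ?thesis by simp
qed

lemma emeasure_lborel_reflect:
  fixes A :: "real set"
  assumes [measurable]: "A \<in> sets borel"
  shows "emeasure lborel {x. - x \<in> A} = emeasure lborel A"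
proof -
  have "emeasure lborel A = emeasure (distr lborel borel uminus) A"
    by (simp add: lborel_distr_uminus)
  also have "\<dots> = emeasure lborel {x. - x \<in> A}"
    by (subst emeasure_distr) (auto simp: vimage_def)
  finally show ?thesis by simp
qed

lemma emeasure_le_SUP_final_segments:
  fixes B :: "real set"
  assumes [measurable]: "B \<in> sets borel" and "B \<noteq> {}"
  shows "emeasure lborel B \<le> (SUP b\<in>B. emeasure lborel (B \<inter> {b..}))"
proof -
  have "emeasure lborel B = emeasure lborel {x. - x \<in> B}"
    by (simp add: emeasure_lborel_reflect)
  also have "\<dots> \<le> (SUP a\<in>{x. - x \<in> B}. emeasure lborel ({x. - x \<in> B} \<inter> {..a}))"
  proof (rule emeasure_le_SUP_initial_segments)
    show "{x. - x \<in> B} \<noteq> {}" using assms(2) by (metis Collect_empty_eq ex_in_conv minus_minus)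
  qed measurable
  also have "\<dots> \<le> (SUP b\<in>B. emeasure lborel (B \<inter> {b..}))"
  proof (rule SUP_least)
    fix a assume "a \<in> {x. - x \<in> B}"
    then have "- a \<in> B" by simp
    have "{x. - x \<in> B} \<inter> {..a} = {x. - x \<in> B \<inter> {- a..}}" by auto
    then have "emeasure lborel ({x. - x \<in> B} \<inter> {..a}) = emeasure lborel (B \<inter> {- a..})"
      by (simp only:) (intro emeasure_lborel_reflect, simp)
    also have "\<dots> \<le> (SUP b\<in>B. emeasure lborel (B \<inter> {b..}))"
      using \<open>- a \<in> B\<close> by (rule SUP_upper)
    finally show "emeasure lborel ({x. - x \<in> B} \<inter> {..a}) \<le> (SUP b\<in>B. emeasure lborel (B \<inter> {b..}))" .
  qed
  finally show ?thesis .
qed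

text \<open>For \<open>a \<in> A\<close> and \<open>b \<in> B\<close> the sumset contains the translates \<open>(A \<inter> {..a}) + b\<close> and
  \<open>a + (B \<inter> {b..})\<close>, which lie on either side of \<open>a + b\<close> and share at most that point. So its measure
  is at least the sum of the measures of the two pieces; then let \<open>a\<close> go up in \<open>A\<close> and \<open>b\<close> go down in
  \<open>B\<close>. Passing to a measurable \<open>C\<close> avoids the question whether \<open>A + B\<close> is measurable.\<close>

theorem brunn_minkowski_real:
  fixes A B C :: "real set"
  assumes [measurable]: "A \<in> sets borel" "B \<in> sets borel" "C \<in> sets borel"
    and ne: "A \<noteq> {}" "B \<noteq> {}"
    and sub: "\<And>x y. x \<in> A \<Longrightarrow> y \<in> B \<Longrightarrow> x + y \<in> C"
  shows "emeasure lborel A + emeasure lborel B \<le> emeasure lborel C"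
proof -
  have *: "emeasure lborel (A \<inter> {..a}) + emeasure lborel (B \<inter> {b..}) \<le> emeasure lborel C"
    if "a \<in> A" "b \<in> B" for a b
  proof -
    have "emeasure lborel (A \<inter> {..a}) + emeasure lborel (B \<inter> {b..})
        = emeasure lborel {x. x - b \<in> A \<inter> {..a}} + emeasure lborel {x. x - a \<in> B \<inter> {b..}}"
      by (subst (1 2) emeasure_lborel_translate) auto
    also have "emeasure lborel {x. x - a \<in> B \<inter> {b..}} = emeasure lborel ({x. x - a \<in> B \<inter> {b..}} - {a + b})"
      by (intro emeasure_Diff_null_set[symmetric]) auto
    also have "emeasure lborel {x. x - b \<in> A \<inter> {..a}} + \<dots>
        = emeasure lborel ({x. x - b \<in> A \<inter> {..a}} \<union> ({x. x - a \<in> B \<inter> {b..}} - {a + b}))"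
      by (intro plus_emeasure) auto
    also have "\<dots> \<le> emeasure lborel C"
      using sub[OF _ that(2)] sub[OF that(1)]
      by (intro emeasure_mono) (auto, (metis diff_add_cancel add.commute)+)
    finally show ?thesis .
  qed
  have "emeasure lborel A + emeasure lborel B
      \<le> (SUP a\<in>A. emeasure lborel (A \<inter> {..a})) + (SUP b\<in>B. emeasure lborel (B \<inter> {b..}))"
    using ne by (intro add_mono emeasure_le_SUP_initial_segments emeasure_le_SUP_final_segments) auto
  also have "\<dots> = (SUP a\<in>A. SUP b\<in>B. emeasure lborel (A \<inter> {..a}) + emeasure lborel (B \<inter> {b..}))"
    using ne
    by (subst ennreal_SUP_add_left[symmetric], simp) (intro SUP_cong ennreal_SUP_add_right, auto)
  also have "\<dots> \<le> emeasure lborel C"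
    using * by (intro SUP_least)
  finally show ?thesis .
qed

lemma emeasure_lborel_dilate:
  fixes A :: "real set"
  assumes [measurable]: "A \<in> sets borel" and "a > 0"
  shows "emeasure lborel {x. x / a \<in> A} = ennreal a * emeasure lborel A"
proof -
  have "emeasure lborel {x. x / a \<in> A} = (\<integral>\<^sup>+x. indicator {x. x / a \<in> A} x \<partial>lborel)"
    by simp
  also have "\<dots> = (\<integral>\<^sup>+x. indicator A (x / a) \<partial>lborel)"
    by (intro nn_integral_cong) (auto split: split_indicator)
  also have "\<dots> = ennreal \<bar>a\<bar> * (\<integral>\<^sup>+x. indicator A ((0 + a * x) / a) \<partial>lborel)"
    using assms by (intro nn_integral_real_affine) auto
  also have "\<dots> = ennreal a * emeasure lborel A"
    using assms by simp
  finally show ?thesis .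
qed

corollary brunn_minkowski_real_combination:
  fixes A B C :: "real set"
  assumes [measurable]: "A \<in> sets borel" "B \<in> sets borel" "C \<in> sets borel"
    and "A \<noteq> {}" "B \<noteq> {}" and ab: "a > 0" "b > 0"
    and sub: "\<And>x y. x \<in> A \<Longrightarrow> y \<in> B \<Longrightarrow> a * x + b * y \<in> C"
  shows "ennreal a * emeasure lborel A + ennreal b * emeasure lborel B \<le> emeasure lborel C"
proof -
  obtain x y where xy: "x \<in> A" "y \<in> B" using assms by auto
  have "emeasure lborel {x. x / a \<in> A} + emeasure lborel {x. x / b \<in> B} \<le> emeasure lborel C"
  proof (rule brunn_minkowski_real)
    have "a * x \<in> {x. x / a \<in> A}" "b * y \<in> {x. x / b \<in> B}" using xy ab by auto
    then show "{x. x / a \<in> A} \<noteq> {}" "{x. x / b \<in> B} \<noteq> {}" by blast+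
    show "u + v \<in> C" if "u \<in> {x. x / a \<in> A}" "v \<in> {x. x / b \<in> B}" for u v
      using sub[of "u / a" "v / b"] that ab by simp
  qed auto
  then show ?thesis
    using ab by (simp add: emeasure_lborel_dilate)
qed

lemma emeasure_lborel_greaterThan: "emeasure lborel {a::real<..} = top"
proof -
  have "of_nat n \<le> emeasure lborel {a<..}" for n
  proof -
    have "of_nat n = emeasure lborel {a<..a + real n}"
      by (simp add: ennreal_of_nat_eq_real_of_nat)
    also have "\<dots> \<le> emeasure lborel {a<..}"
      by (intro emeasure_mono) auto
    finally show ?thesis .
  qed
  then have "(SUP n. of_nat n) \<le> emeasure lborel {a<..}"
    by (intro SUP_least)
  then show ?thesis
    by (simp add: ennreal_SUP_of_nat_eq_top top_unique)
qed

text \<open>Write \<open>F x\<close> as the length of \<open>{s. 0 < s \<and> s \<le> F x}\<close> and exchange the order of integration. Closed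
  superlevel sets are used because the hypotheses of the inequalities below are non-strict.\<close>

lemma nn_integral_layer_cake:
  assumes "sigma_finite_measure M" and [measurable]: "F \<in> borel_measurable M"
  shows "(\<integral>\<^sup>+x. F x \<partial>M)
    = (\<integral>\<^sup>+s. indicator {0<..} s * emeasure M {x \<in> space M. ennreal s \<le> F x} \<partial>lborel)"
proof -
  interpret sigma_finite_measure M by fact
  interpret pair_sigma_finite lborel M
    by (simp add: pair_sigma_finite.intro sigma_finite_measure_axioms lborel.sigma_finite_measure_axioms)
  have *: "y = (\<integral>\<^sup>+s. indicator {s. 0 < s \<and> ennreal s \<le> y} s \<partial>lborel)" for y
  proof (cases y)
    case (real r)
    then have "{s. 0 < s \<and> ennreal s \<le> y} = {0<..r}" by auto
    then show ?thesis using real by simp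
  next
    case top
    then have "{s. 0 < s \<and> ennreal s \<le> y} = {0<..}" by auto
    then show ?thesis using top by (simp add: emeasure_lborel_greaterThan)
  qed
  have "(\<integral>\<^sup>+x. F x \<partial>M) = (\<integral>\<^sup>+x. (\<integral>\<^sup>+s. indicator {s. 0 < s \<and> ennreal s \<le> F x} s \<partial>lborel) \<partial>M)"
    by (subst (1) *) simp
  also have "\<dots> = (\<integral>\<^sup>+x. (\<integral>\<^sup>+s. (if 0 < s \<and> ennreal s \<le> F x then 1 else 0) \<partial>lborel) \<partial>M)"
    by (intro nn_integral_cong) (auto simp: indicator_def)
  also have "\<dots> = (\<integral>\<^sup>+s. (\<integral>\<^sup>+x. (if 0 < s \<and> ennreal s \<le> F x then 1 else 0) \<partial>M) \<partial>lborel)"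
    by (rule Fubini') measurable
  also have "\<dots> = (\<integral>\<^sup>+s. indicator {0<..} s * emeasure M {x \<in> space M. ennreal s \<le> F x} \<partial>lborel)"
  proof (rule nn_integral_cong)
    fix s :: real
    have "(\<integral>\<^sup>+x. (if 0 < s \<and> ennreal s \<le> F x then 1 else 0) \<partial>M)
      = (\<integral>\<^sup>+x. indicator {0<..} s * indicator {x \<in> space M. ennreal s \<le> F x} x \<partial>M)"
      by (intro nn_integral_cong) (auto simp: indicator_def)
    then show "(\<integral>\<^sup>+x. (if 0 < s \<and> ennreal s \<le> F x then 1 else 0) \<partial>M)
      = indicator {0<..} s * emeasure M {x \<in> space M. ennreal s \<le> F x}"
      by (simp add: nn_integral_cmult)
  qed
  finally show ?thesis .
qed

section \<open>Measures on the line with quasi-concave densities\<close>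

lemma sigma_finite_quasi_concave:
  assumes "has_quasi_concave_density_max_at_0 M"
  shows "sigma_finite_measure M"
proof -
  obtain \<phi> where "\<phi> \<in> borel_measurable borel" "M = density lborel (\<lambda>x. ennreal (\<phi> x))"
    using assms unfolding has_quasi_concave_density_max_at_0_def by blast
  then show ?thesis
    by (simp add: sigma_finite_measure.sigma_finite_iff_density_finite[OF lborel.sigma_finite_measure_axioms])
qed

lemma sets_quasi_concave:
  "has_quasi_concave_density_max_at_0 M \<Longrightarrow> sets M = sets borel"
  by (auto simp: has_quasi_concave_density_max_at_0_def)

lemma space_quasi_concave:
  "has_quasi_concave_density_max_at_0 M \<Longrightarrow> space M = UNIV"
  by (auto simp: has_quasi_concave_density_max_at_0_def)

text \<open>The nonempty superlevel sets of \<open>\<phi>\<close> at positive heights are convex and contain the origin, so they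
  are closed under combinations whose nonnegative coefficients add up to at most \<open>1\<close>.\<close>

lemma density_level_combination:
  assumes qc: "quasi_concave \<phi>" and max: "\<And>x. \<phi> x \<le> \<phi> 0"
    and ab: "0 < a" "0 < b" "a + b \<le> 1" and "c > 0" "c \<le> \<phi> x" "c \<le> \<phi> y"
  shows "c \<le> \<phi> (a * x + b * y)"
proof -
  have min: "min (\<phi> u) (\<phi> v) \<le> \<phi> ((1 - t) * u + t * v)"
    if "c \<le> \<phi> u" "c \<le> \<phi> v" "t \<in> {0..1}" for u v t
    using qc that \<open>c > 0\<close> unfolding quasi_concave_def by (smt (verit) mult_pos_pos)
  \<comment> \<open>\<open>a x + b y\<close> lies on the segment from the origin to the convex combination \<open>z\<close>.\<close>
  define z where "z = (1 - b / (a + b)) * x + (b / (a + b)) * y"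
  have "1 - b / (a + b) = a / (a + b)" using ab by (simp add: field_simps)
  then have z: "(a + b) * z = a * x + b * y"
    using ab by (simp add: z_def distrib_left)
  have "c \<le> \<phi> z"
    using min[of x y "b / (a + b)"] assms by (auto simp: z_def)
  moreover have "c \<le> \<phi> 0" using max[of x] assms by linarith
  ultimately have "c \<le> \<phi> ((1 - (1 - (a + b))) * z + (1 - (a + b)) * 0)"
    using min[of z 0 "1 - (a + b)"] ab by auto
  also have "(1 - (1 - (a + b))) * z + (1 - (a + b)) * 0 = a * x + b * y"
    using z by simp
  finally show ?thesis .
qed

text \<open>Slice the measure into the Lebesgue measures of the superlevel sets of the density. Each level set
  \<open>L\<close> is closed under the combination, so Brunn-Minkowski applies to \<open>A \<inter> L\<close>, \<open>B \<inter> L\<close>, \<open>C \<inter> L\<close>; that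
  the origin lies in \<open>A\<close>, \<open>B\<close> and every nonempty level makes the two summands nonempty. The result is
  linear in the measures and may be integrated over the levels.\<close>

lemma brunn_minkowski_quasi_concave_density:
  fixes \<phi> :: "real \<Rightarrow> real"
  assumes [measurable]: "\<phi> \<in> borel_measurable borel"
    and "\<And>x. \<phi> x \<ge> 0" and qc: "quasi_concave \<phi>" and max: "\<And>x. \<phi> x \<le> \<phi> 0"
    and [measurable]: "A \<in> sets borel" "B \<in> sets borel" "C \<in> sets borel"
    and "0 \<in> A" "0 \<in> B" and ab: "0 < a" "0 < b" "a + b \<le> 1"
    and sub: "\<And>x y. x \<in> A \<Longrightarrow> y \<in> B \<Longrightarrow> a * x + b * y \<in> C"
  defines "m \<equiv> density lborel (\<lambda>x. ennreal (\<phi> x))"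
  shows "ennreal a * emeasure m A + ennreal b * emeasure m B \<le> emeasure m C"
proof -
  have layers: "emeasure m S
      = (\<integral>\<^sup>+c. indicator {0<..} c * emeasure lborel {x \<in> S. c \<le> \<phi> x} \<partial>lborel)"
    and layers_measurable: "(\<lambda>c. indicator {0<..} c * emeasure lborel {x \<in> S. c \<le> \<phi> x}) \<in> borel_measurable borel"
    if [measurable]: "S \<in> sets borel" for S
  proof -
    have "emeasure m S = (\<integral>\<^sup>+x. ennreal (\<phi> x) * indicator S x \<partial>lborel)"
      by (simp add: m_def emeasure_density)
    also have "\<dots> = (\<integral>\<^sup>+c. indicator {0<..} c *
        emeasure lborel {x \<in> space lborel. ennreal c \<le> ennreal (\<phi> x) * indicator S x} \<partial>lborel)"
      by (intro nn_integral_layer_cake lborel.sigma_finite_measure_axioms) simp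
    also have "\<dots> = (\<integral>\<^sup>+c. indicator {0<..} c * emeasure lborel {x \<in> S. c \<le> \<phi> x} \<partial>lborel)"
      using assms(2)
      by (intro nn_integral_cong) (auto split: split_indicator intro!: arg_cong[where f="emeasure lborel"])
    finally show "emeasure m S
      = (\<integral>\<^sup>+c. indicator {0<..} c * emeasure lborel {x \<in> S. c \<le> \<phi> x} \<partial>lborel)" .
    have "(\<lambda>c. emeasure lborel {x \<in> space lborel. x \<in> S \<and> c \<le> \<phi> x}) \<in> borel_measurable borel"
      by measurable
    then show "(\<lambda>c. indicator {0<..} c * emeasure lborel {x \<in> S. c \<le> \<phi> x}) \<in> borel_measurable borel"
      by simp
  qed
  have "ennreal a * emeasure m A + ennreal b * emeasure m B
    = (\<integral>\<^sup>+c. ennreal a * (indicator {0<..} c * emeasure lborel {x \<in> A. c \<le> \<phi> x})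
        + ennreal b * (indicator {0<..} c * emeasure lborel {x \<in> B. c \<le> \<phi> x}) \<partial>lborel)"
    using layers_measurable[of A] layers_measurable[of B]
    by (simp add: layers nn_integral_add nn_integral_cmult)
  also have "\<dots> \<le> (\<integral>\<^sup>+c. indicator {0<..} c * emeasure lborel {x \<in> C. c \<le> \<phi> x} \<partial>lborel)"
  proof (rule nn_integral_mono)
    fix c :: real
    show "ennreal a * (indicator {0<..} c * emeasure lborel {x \<in> A. c \<le> \<phi> x})
        + ennreal b * (indicator {0<..} c * emeasure lborel {x \<in> B. c \<le> \<phi> x})
        \<le> indicator {0<..} c * emeasure lborel {x \<in> C. c \<le> \<phi> x}"
    proof (cases "0 < c \<and> c \<le> \<phi> 0")
      case True
      have "ennreal a * emeasure lborel {x \<in> A. c \<le> \<phi> x} + ennreal b * emeasure lborel {x \<in> B. c \<le> \<phi> x}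
          \<le> emeasure lborel {x \<in> C. c \<le> \<phi> x}"
      proof (rule brunn_minkowski_real_combination)
        show "{x \<in> A. c \<le> \<phi> x} \<noteq> {}" "{x \<in> B. c \<le> \<phi> x} \<noteq> {}"
          using True assms by blast+
        show "a * x + b * y \<in> {x \<in> C. c \<le> \<phi> x}"
          if "x \<in> {x \<in> A. c \<le> \<phi> x}" "y \<in> {x \<in> B. c \<le> \<phi> x}" for x y
          using that True sub density_level_combination[OF qc max ab] by auto
      qed (use ab in auto)
      then show ?thesis using True by simp
    next
      case False
      then have empty: "{x \<in> S. c \<le> \<phi> x} = {}" if "c > 0" for S
        using max that order_trans by blast
      show ?thesis by (cases "c > 0") (simp_all add: empty)
    qed
  qed
  also have "\<dots> = emeasure m C"
    by (simp add: layers)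
  finally show ?thesis .
qed

section \<open>The Prekopa-Leindler inequality on the line\<close>

text \<open>When \<open>F\<close> and \<open>G\<close> both have maximum \<open>1\<close>, attained at the origin, their superlevel sets for each
  \<open>s \<in> (0, 1]\<close> contain the origin and are empty for \<open>s > 1\<close>. So the previous inequality holds level by
  level, with no level at which only one of the sets is empty.\<close>

lemma linear_prekopa_leindler_real:
  fixes \<phi> :: "real \<Rightarrow> real" and F G H :: "real \<Rightarrow> ennreal"
  assumes \<phi>: "\<phi> \<in> borel_measurable borel" "\<And>x. \<phi> x \<ge> 0" "quasi_concave \<phi>" "\<And>x. \<phi> x \<le> \<phi> 0"
    and [measurable]: "F \<in> borel_measurable borel" "G \<in> borel_measurable borel" "H \<in> borel_measurable borel"
    and F: "F 0 = 1" "\<And>x. F x \<le> 1" and G: "G 0 = 1" "\<And>x. G x \<le> 1"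
    and ab: "0 < a" "0 < b" "a + b \<le> 1"
    and FGH: "\<And>x y s. 0 < s \<Longrightarrow> s \<le> 1 \<Longrightarrow> ennreal s \<le> F x \<Longrightarrow> ennreal s \<le> G y \<Longrightarrow>
      ennreal s \<le> H (a * x + b * y)"
  defines "m \<equiv> density lborel (\<lambda>x. ennreal (\<phi> x))"
  shows "ennreal a * (\<integral>\<^sup>+x. F x \<partial>m) + ennreal b * (\<integral>\<^sup>+x. G x \<partial>m) \<le> (\<integral>\<^sup>+x. H x \<partial>m)"
proof -
  have sf: "sigma_finite_measure m"
    unfolding m_def
    by (rule sigma_finite_quasi_concave) (unfold has_quasi_concave_density_max_at_0_def, use \<phi> in blast)
  have [measurable_cong]: "sets m = sets borel" by (simp add: m_def)
  have layers: "(\<integral>\<^sup>+x. K x \<partial>m) = (\<integral>\<^sup>+s. indicator {0<..} s * emeasure m {x. ennreal s \<le> K x} \<partial>lborel)"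
    and layers_measurable: "(\<lambda>s. indicator {0<..} s * emeasure m {x. ennreal s \<le> K x}) \<in> borel_measurable borel"
    if [measurable]: "K \<in> borel_measurable borel" for K
  proof -
    interpret sigma_finite_measure m by fact
    have sp: "space m = UNIV" by (simp add: m_def)
    have "K \<in> borel_measurable m" by measurable
    from nn_integral_layer_cake[OF sf this]
    show "(\<integral>\<^sup>+x. K x \<partial>m) = (\<integral>\<^sup>+s. indicator {0<..} s * emeasure m {x. ennreal s \<le> K x} \<partial>lborel)"
      by (simp add: sp)
    have "(\<lambda>s. emeasure m {x \<in> space m. ennreal s \<le> K x}) \<in> borel_measurable borel"
      by measurable
    then show "(\<lambda>s. indicator {0<..} s * emeasure m {x. ennreal s \<le> K x}) \<in> borel_measurable borel"
      by (simp add: sp)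
  qed
  have "ennreal a * (\<integral>\<^sup>+x. F x \<partial>m) + ennreal b * (\<integral>\<^sup>+x. G x \<partial>m)
    = (\<integral>\<^sup>+s. ennreal a * (indicator {0<..} s * emeasure m {x. ennreal s \<le> F x})
        + ennreal b * (indicator {0<..} s * emeasure m {x. ennreal s \<le> G x}) \<partial>lborel)"
    using layers_measurable[of F] layers_measurable[of G]
    by (simp add: layers nn_integral_add nn_integral_cmult)
  also have "\<dots> \<le> (\<integral>\<^sup>+s. indicator {0<..} s * emeasure m {x. ennreal s \<le> H x} \<partial>lborel)"
  proof (rule nn_integral_mono)
    fix s :: real
    show "ennreal a * (indicator {0<..} s * emeasure m {x. ennreal s \<le> F x})
        + ennreal b * (indicator {0<..} s * emeasure m {x. ennreal s \<le> G x})
        \<le> indicator {0<..} s * emeasure m {x. ennreal s \<le> H x}"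
    proof (cases "0 < s \<and> s \<le> 1")
      case True
      have "ennreal a * emeasure m {x. ennreal s \<le> F x} + ennreal b * emeasure m {x. ennreal s \<le> G x}
          \<le> emeasure m {x. ennreal s \<le> H x}"
        unfolding m_def
        by (rule brunn_minkowski_quasi_concave_density[OF \<phi>])
          (use True F G FGH ab in \<open>auto simp: ennreal_le_1\<close>)
      then show ?thesis using True by simp
    next
      case False
      have "\<not> ennreal s \<le> F x" "\<not> ennreal s \<le> G x" if "s > 1" for x
        using F(2)[of x] G(2)[of x] that ennreal_le_1[of s] by (meson not_le order_trans)+
      then show ?thesis using False by (cases "s > 1") auto
    qed
  qed
  also have "\<dots> = (\<integral>\<^sup>+x. H x \<partial>m)"
    by (simp add: layers)
  finally show ?thesis .
qed

text \<open>Dividing \<open>F\<close> and \<open>G\<close> by their maxima \<open>u\<close> and \<open>v\<close> turns the multiplicative hypothesis into the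
  levelwise one. The resulting linear inequality is homogeneous, and the weighted inequality between
  arithmetic and geometric means makes the maxima cancel.\<close>

lemma prekopa_leindler_real_bounded:
  fixes \<phi> :: "real \<Rightarrow> real" and F G H :: "real \<Rightarrow> ennreal"
  assumes \<phi>: "\<phi> \<in> borel_measurable borel" "\<And>x. \<phi> x \<ge> 0" "quasi_concave \<phi>" "\<And>x. \<phi> x \<le> \<phi> 0"
    and [measurable]: "F \<in> borel_measurable borel" "G \<in> borel_measurable borel" "H \<in> borel_measurable borel"
    and F: "\<And>x. F x \<le> F 0" "F 0 < top" and G: "\<And>x. G x \<le> G 0" "G 0 < top"
    and l: "0 < l" "l < 1" and \<alpha>\<beta>: "0 < \<alpha>" "0 < \<beta>" "(1 - l) * \<alpha> + l * \<beta> \<le> 1" and "0 < K"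
    and FGH: "\<And>x y. ennreal K * (ennpowr (F x) (1 - l) * ennpowr (G y) l)
      \<le> H ((1 - l) * \<alpha> * x + l * \<beta> * y)"
  defines "m \<equiv> density lborel (\<lambda>x. ennreal (\<phi> x))"
  shows "ennreal (K * (\<alpha> powr (1 - l) * \<beta> powr l))
      * (ennpowr (\<integral>\<^sup>+x. F x \<partial>m) (1 - l) * ennpowr (\<integral>\<^sup>+x. G x \<partial>m) l) \<le> (\<integral>\<^sup>+x. H x \<partial>m)"
proof (cases "F 0 = 0 \<or> G 0 = 0")
  case True
  then have "(\<forall>x. F x = 0) \<or> (\<forall>x. G x = 0)"
    using F(1) G(1) by (metis le_zero_eq)
  then show ?thesis by auto
next
  case False
  then obtain u v where u: "F 0 = ennreal u" "u > 0" and v: "G 0 = ennreal v" "v > 0"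
    using F(2) G(2) by (metis ennreal_cases ennreal_0 less_irrefl order_le_less infinity_ennreal_def)
  \<comment> \<open>the lower bound for \<open>H\<close> that corresponds to the maxima \<open>u\<close> and \<open>v\<close>\<close>
  define \<kappa> where "\<kappa> = K * (u powr (1 - l) * v powr l)"
  have "\<kappa> > 0" using u v \<open>0 < K\<close> by (simp add: \<kappa>_def)
  have [measurable_cong]: "sets m = sets borel" by (simp add: m_def)
  have rescale: "ennreal s \<le> ennreal (1 / c) * z \<longleftrightarrow> ennreal (s * c) \<le> z" if "c > 0" "s \<ge> 0" for s c z
    using that by (cases z) (auto simp: ennreal_mult_top pos_le_divide_eq simp flip: ennreal_mult)
  have "ennreal ((1 - l) * \<alpha>) * (\<integral>\<^sup>+x. ennreal (1 / u) * F x \<partial>m)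
      + ennreal (l * \<beta>) * (\<integral>\<^sup>+x. ennreal (1 / v) * G x \<partial>m) \<le> (\<integral>\<^sup>+x. ennreal (1 / \<kappa>) * H x \<partial>m)"
    unfolding m_def
  proof (rule linear_prekopa_leindler_real[OF \<phi>])
    have scaled_le: "ennreal (1 / c) * x \<le> 1" "ennreal (1 / c) * ennreal c = 1" if "x \<le> ennreal c" "c > 0" for x c
    proof -
      show *: "ennreal (1 / c) * ennreal c = 1" using that by (simp flip: ennreal_mult)
      have "ennreal (1 / c) * x \<le> ennreal (1 / c) * ennreal c" using that by (intro mult_left_mono) auto
      then show "ennreal (1 / c) * x \<le> 1" by (simp only: *)
    qed
    show "ennreal (1 / u) * F 0 = 1" "ennreal (1 / v) * G 0 = 1"
      using scaled_le(2)[OF order_refl] u v by simp_all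
    show "ennreal (1 / u) * F x \<le> 1" "ennreal (1 / v) * G x \<le> 1" for x
      using scaled_le(1) u v F(1) G(1) by simp_all
    show "ennreal s \<le> ennreal (1 / \<kappa>) * H ((1 - l) * \<alpha> * x + l * \<beta> * y)"
      if s: "0 < s" "s \<le> 1" and sF: "ennreal s \<le> ennreal (1 / u) * F x" and sG: "ennreal s \<le> ennreal (1 / v) * G y"
      for x y s
    proof -
      have "s powr (1 - l) * s powr l = s" using s by (simp flip: powr_add)
      then have "s * \<kappa> = K * ((s * u) powr (1 - l) * (s * v) powr l)"
        using s u v by (simp add: \<kappa>_def powr_mult mult_ac)
      then have "ennreal (s * \<kappa>) = ennreal K * (ennpowr (ennreal (s * u)) (1 - l) * ennpowr (ennreal (s * v)) l)"
        using s u v \<open>0 < K\<close> by (simp add: ennpowr_ennreal flip: ennreal_mult)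
      also have "\<dots> \<le> ennreal K * (ennpowr (F x) (1 - l) * ennpowr (G y) l)"
        using sF sG rescale[of u s] rescale[of v s] u v s l
        by (intro mult_left_mono mult_mono ennpowr_mono) auto
      also note FGH
      finally show ?thesis using rescale[of \<kappa> s] s \<open>\<kappa> > 0\<close> by simp
    qed
  qed (use l \<alpha>\<beta> in auto)
  then have linear: "ennreal (1 - l) * (ennreal (\<alpha> / u) * (\<integral>\<^sup>+x. F x \<partial>m))
      + ennreal l * (ennreal (\<beta> / v) * (\<integral>\<^sup>+x. G x \<partial>m)) \<le> ennreal (1 / \<kappa>) * (\<integral>\<^sup>+x. H x \<partial>m)"
    using l \<alpha>\<beta> u v by (simp add: nn_integral_cmult mult.assoc[symmetric] ennreal_mult[symmetric])
  have "K * (\<alpha> powr (1 - l) * \<beta> powr l) = \<kappa> * ((\<alpha> / u) powr (1 - l) * (\<beta> / v) powr l)"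
    using \<alpha>\<beta> u v by (simp add: \<kappa>_def powr_divide)
  then have "ennreal (K * (\<alpha> powr (1 - l) * \<beta> powr l))
        * (ennpowr (\<integral>\<^sup>+x. F x \<partial>m) (1 - l) * ennpowr (\<integral>\<^sup>+x. G x \<partial>m) l)
      = ennreal \<kappa> * ((ennreal ((\<alpha> / u) powr (1 - l)) * ennpowr (\<integral>\<^sup>+x. F x \<partial>m) (1 - l))
        * (ennreal ((\<beta> / v) powr l) * ennpowr (\<integral>\<^sup>+x. G x \<partial>m) l))"
    using \<open>\<kappa> > 0\<close> by (simp add: ennreal_mult mult_ac)
  also have "\<dots> = ennreal \<kappa> * (ennpowr (ennreal (\<alpha> / u) * (\<integral>\<^sup>+x. F x \<partial>m)) (1 - l)
        * ennpowr (ennreal (\<beta> / v) * (\<integral>\<^sup>+x. G x \<partial>m)) l)"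
    using \<alpha>\<beta> u v by (simp add: ennpowr_cmult)
  also have "\<dots> \<le> ennreal \<kappa> * (ennreal (1 / \<kappa>) * (\<integral>\<^sup>+x. H x \<partial>m))"
    using order_trans[OF ennpowr_weighted_AM_GM[OF l] linear] by (intro mult_left_mono) auto
  also have "\<dots> = (\<integral>\<^sup>+x. H x \<partial>m)"
    using \<open>\<kappa> > 0\<close> by (simp add: mult.assoc[symmetric] ennreal_mult[symmetric])
  finally show ?thesis .
qed

lemma nn_integral_eq_SUP_truncations:
  assumes [measurable]: "F \<in> borel_measurable M"
  shows "(\<integral>\<^sup>+x. F x \<partial>M) = (SUP n. \<integral>\<^sup>+x. min (F x) (of_nat n) \<partial>M)"
proof -
  have "F x = (SUP n. min (F x) (of_nat n))" for x
    by (simp add: inf_min[symmetric] inf_SUP[symmetric] ennreal_SUP_of_nat_eq_top)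
  then have "(\<integral>\<^sup>+x. F x \<partial>M) = (\<integral>\<^sup>+x. (SUP n. min (F x) (of_nat n)) \<partial>M)"
    by simp
  also have "\<dots> = (SUP n. \<integral>\<^sup>+x. min (F x) (of_nat n) \<partial>M)"
    by (intro nn_integral_monotone_convergence_SUP)
      (simp_all add: incseq_def le_fun_def min.coboundedI2)
  finally show ?thesis .
qed

text \<open>The partial integrals to which this is applied need not be finite, even at the origin; truncating \<open>F\<close>
  and \<open>G\<close> at integer heights keeps the hypotheses and monotone convergence removes the truncation.
  The factor \<open>K\<close> carries the constant from the coordinates already integrated.\<close>

theorem prekopa_leindler_real:
  fixes \<phi> :: "real \<Rightarrow> real" and F G H :: "real \<Rightarrow> ennreal"
  assumes \<phi>: "\<phi> \<in> borel_measurable borel" "\<And>x. \<phi> x \<ge> 0" "quasi_concave \<phi>" "\<And>x. \<phi> x \<le> \<phi> 0"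
    and [measurable]: "F \<in> borel_measurable borel" "G \<in> borel_measurable borel" "H \<in> borel_measurable borel"
    and F: "\<And>x. F x \<le> F 0" and G: "\<And>x. G x \<le> G 0"
    and l: "0 < l" "l < 1" and \<alpha>\<beta>: "0 < \<alpha>" "0 < \<beta>" "(1 - l) * \<alpha> + l * \<beta> \<le> 1" and "0 < K"
    and FGH: "\<And>x y. ennreal K * (ennpowr (F x) (1 - l) * ennpowr (G y) l)
      \<le> H ((1 - l) * \<alpha> * x + l * \<beta> * y)"
  defines "m \<equiv> density lborel (\<lambda>x. ennreal (\<phi> x))"
  shows "ennreal (K * (\<alpha> powr (1 - l) * \<beta> powr l))
      * (ennpowr (\<integral>\<^sup>+x. F x \<partial>m) (1 - l) * ennpowr (\<integral>\<^sup>+x. G x \<partial>m) l) \<le> (\<integral>\<^sup>+x. H x \<partial>m)"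
proof -
  have [measurable_cong]: "sets m = sets borel" by (simp add: m_def)
  have truncated: "ennreal (K * (\<alpha> powr (1 - l) * \<beta> powr l))
      * (ennpowr (\<integral>\<^sup>+x. min (F x) (of_nat i) \<partial>m) (1 - l) * ennpowr (\<integral>\<^sup>+x. min (G x) (of_nat j) \<partial>m) l)
      \<le> (\<integral>\<^sup>+x. H x \<partial>m)" for i j :: nat
    unfolding m_def
  proof (rule prekopa_leindler_real_bounded[OF \<phi>])
    show "ennreal K * (ennpowr (min (F x) (of_nat i)) (1 - l) * ennpowr (min (G y) (of_nat j)) l)
      \<le> H ((1 - l) * \<alpha> * x + l * \<beta> * y)" for x y
      by (rule order_trans[OF _ FGH]) (use l in \<open>intro mult_left_mono mult_mono ennpowr_mono, auto\<close>)
    show "min (F x) (of_nat i) \<le> min (F 0) (of_nat i)" "min (G x) (of_nat j) \<le> min (G 0) (of_nat j)" for x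
      by (intro min.mono F G order_refl)+
    show "min (F 0) (of_nat i) < top" "min (G 0) (of_nat j) < top"
      by (simp_all add: min_less_iff_disj ennreal_of_nat_eq_real_of_nat)
  qed (use l \<alpha>\<beta> \<open>0 < K\<close> in auto)
  have FG: "(\<integral>\<^sup>+x. F x \<partial>m) = (SUP n. \<integral>\<^sup>+x. min (F x) (of_nat n) \<partial>m)"
    "(\<integral>\<^sup>+x. G x \<partial>m) = (SUP n. \<integral>\<^sup>+x. min (G x) (of_nat n) \<partial>m)"
    by (intro nn_integral_eq_SUP_truncations; measurable)+
  show ?thesis
    using l truncated unfolding FG
    by (simp add: ennpowr_SUP SUP_mult_left_ennreal SUP_mult_right_ennreal SUP_least)
qed

section \<open>Product measures\<close>

text \<open>Induction on the coordinates. For fixed values \<open>s\<close> and \<open>r\<close> of the new coordinate the induction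
  hypothesis applies to the sections of \<open>F\<close>, \<open>G\<close> and \<open>H\<close>. It yields a one-dimensional inequality between
  the partial integrals, viewed as functions of the new coordinate. These attain their maximum at \<open>0\<close>,
  since \<open>F\<close> and \<open>G\<close> increase when a coordinate is set to \<open>0\<close>; hence the inequality on the line applies.\<close>

theorem prekopa_leindler_PiM:
  fixes M :: "'i \<Rightarrow> real measure" and F G H :: "('i \<Rightarrow> real) \<Rightarrow> ennreal"
  assumes M: "\<And>i. has_quasi_concave_density_max_at_0 (M i)"
    and l: "0 < l" "l < 1" and \<alpha>\<beta>: "0 < \<alpha>" "0 < \<beta>" "(1 - l) * \<alpha> + l * \<beta> \<le> 1"
    and "finite I"
    and "F \<in> borel_measurable (PiM I M)" "G \<in> borel_measurable (PiM I M)" "H \<in> borel_measurable (PiM I M)"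
    and "\<And>x i. x \<in> extensional I \<Longrightarrow> i \<in> I \<Longrightarrow> F x \<le> F (x(i := 0))"
    and "\<And>x i. x \<in> extensional I \<Longrightarrow> i \<in> I \<Longrightarrow> G x \<le> G (x(i := 0))"
    and "\<And>x y. x \<in> extensional I \<Longrightarrow> y \<in> extensional I \<Longrightarrow>
      ennpowr (F x) (1 - l) * ennpowr (G y) l \<le> H (\<lambda>i\<in>I. (1 - l) * \<alpha> * x i + l * \<beta> * y i)"
  shows "ennreal ((\<alpha> powr (1 - l) * \<beta> powr l) ^ card I)
      * (ennpowr (\<integral>\<^sup>+x. F x \<partial>PiM I M) (1 - l) * ennpowr (\<integral>\<^sup>+x. G x \<partial>PiM I M) l)
    \<le> (\<integral>\<^sup>+x. H x \<partial>PiM I M)"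
proof -
  interpret product_sigma_finite M
    by (intro product_sigma_finite.intro sigma_finite_quasi_concave M)
  show ?thesis
    using assms(7-)
  proof (induction I arbitrary: F G H)
    case empty
    then show ?case
      by (simp add: nn_integral_empty restrict_def)
  next
    case (insert i I)
    note [measurable] = insert.prems(1-3)
    obtain \<phi> where \<phi>: "\<phi> \<in> borel_measurable borel" "\<And>x. \<phi> x \<ge> 0" "quasi_concave \<phi>" "\<And>x. \<phi> x \<le> \<phi> 0"
      and Mi: "M i = density lborel (\<lambda>x. ennreal (\<phi> x))"
      using M[of i] unfolding has_quasi_concave_density_max_at_0_def by blast
    have sets_Mi: "sets (M i) = sets borel" by (simp add: Mi)
    have space_PiM_I: "space (PiM J M) = extensional J" for J
      using M by (simp add: space_PiM PiE_def space_quasi_concave Pi_def)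
    define c where "c = \<alpha> powr (1 - l) * \<beta> powr l"
    interpret I: sigma_finite_measure "PiM I M" by (rule sigma_finite) fact
    have section_measurable: "(\<lambda>x. K (x(i := s))) \<in> borel_measurable (PiM I M)"
      and partial_measurable: "(\<lambda>s. \<integral>\<^sup>+x. K (x(i := s)) \<partial>PiM I M) \<in> borel_measurable borel"
      if [measurable]: "K \<in> borel_measurable (PiM (insert i I) M)" for K :: "('i \<Rightarrow> real) \<Rightarrow> ennreal" and s
    proof -
      have [measurable]: "s \<in> space (M i)" by (simp add: Mi)
      show "(\<lambda>x. K (x(i := s))) \<in> borel_measurable (PiM I M)" by measurable
      have "(\<lambda>s. \<integral>\<^sup>+x. K (x(i := s)) \<partial>PiM I M) \<in> borel_measurable (M i)" by measurable
      then show "(\<lambda>s. \<integral>\<^sup>+x. K (x(i := s)) \<partial>PiM I M) \<in> borel_measurable borel"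
        by (simp add: measurable_cong_sets[OF sets_Mi refl])
    qed
    have ext_upd: "x(i := s) \<in> extensional (insert i I)" if "x \<in> extensional I" for x and s :: real
      using that by (auto simp: extensional_def)
    have "ennreal (c ^ card I * (\<alpha> powr (1 - l) * \<beta> powr l))
        * (ennpowr (\<integral>\<^sup>+s. (\<integral>\<^sup>+x. F (x(i := s)) \<partial>PiM I M) \<partial>M i) (1 - l)
          * ennpowr (\<integral>\<^sup>+s. (\<integral>\<^sup>+x. G (x(i := s)) \<partial>PiM I M) \<partial>M i) l)
        \<le> (\<integral>\<^sup>+s. (\<integral>\<^sup>+x. H (x(i := s)) \<partial>PiM I M) \<partial>M i)"
      unfolding Mi
    proof (rule prekopa_leindler_real[OF \<phi>])
      show "(\<integral>\<^sup>+x. F (x(i := s)) \<partial>PiM I M) \<le> (\<integral>\<^sup>+x. F (x(i := 0)) \<partial>PiM I M)" for s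
      proof (rule nn_integral_mono)
        fix x assume "x \<in> space (PiM I M)"
        then show "F (x(i := s)) \<le> F (x(i := 0))"
          using insert.prems(4)[OF ext_upd[of x s], of i] unfolding space_PiM_I fun_upd_upd by blast
      qed
      show "(\<integral>\<^sup>+x. G (x(i := s)) \<partial>PiM I M) \<le> (\<integral>\<^sup>+x. G (x(i := 0)) \<partial>PiM I M)" for s
      proof (rule nn_integral_mono)
        fix x assume "x \<in> space (PiM I M)"
        then show "G (x(i := s)) \<le> G (x(i := 0))"
          using insert.prems(5)[OF ext_upd[of x s], of i] unfolding space_PiM_I fun_upd_upd by blast
      qed
      show "ennreal (c ^ card I) * (ennpowr (\<integral>\<^sup>+x. F (x(i := s)) \<partial>PiM I M) (1 - l)
          * ennpowr (\<integral>\<^sup>+x. G (x(i := r)) \<partial>PiM I M) l)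
        \<le> (\<integral>\<^sup>+x. H (x(i := (1 - l) * \<alpha> * s + l * \<beta> * r)) \<partial>PiM I M)" for s r
        unfolding c_def
      proof (rule insert.IH)
        show "F (x(i := s)) \<le> F ((x(j := 0))(i := s))" "G (x(i := r)) \<le> G ((x(j := 0))(i := r))"
          if "x \<in> extensional I" "j \<in> I" for x j
        proof -
          have "(x(i := u))(j := 0) = (x(j := 0))(i := u)" for u
            using that insert.hyps by (intro fun_upd_twist) auto
          then show "F (x(i := s)) \<le> F ((x(j := 0))(i := s))" "G (x(i := r)) \<le> G ((x(j := 0))(i := r))"
            using insert.prems(4)[OF ext_upd[OF that(1), of s], of j]
              insert.prems(5)[OF ext_upd[OF that(1), of r], of j] that(2)
            by (simp_all only: insert_iff simp_thms)
        qed
        show "ennpowr (F (x(i := s))) (1 - l) * ennpowr (G (y(i := r))) l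
            \<le> H ((\<lambda>j\<in>I. (1 - l) * \<alpha> * x j + l * \<beta> * y j)(i := (1 - l) * \<alpha> * s + l * \<beta> * r))"
          if "x \<in> extensional I" "y \<in> extensional I" for x y
        proof -
          have "(\<lambda>j\<in>insert i I. (1 - l) * \<alpha> * (x(i := s)) j + l * \<beta> * (y(i := r)) j)
              = (\<lambda>j\<in>I. (1 - l) * \<alpha> * x j + l * \<beta> * y j)(i := (1 - l) * \<alpha> * s + l * \<beta> * r)"
            using insert.hyps by (auto simp: fun_eq_iff)
          then show ?thesis
            using insert.prems(6)[OF ext_upd[OF that(1), of s] ext_upd[OF that(2), of r]] by (simp only:)
        qed
      qed (intro section_measurable; fact)+
      show "0 < c ^ card I" using \<alpha>\<beta> by (simp add: c_def)
    qed (intro partial_measurable l \<alpha>\<beta>; fact)+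
    then show ?case
      using insert.hyps
      by (simp add: product_nn_integral_insert_rev c_def mult.commute)
  qed
qed

section \<open>Absolute continuity of the product measure\<close>

lemma measurable_vec_lambda:
  "(\<lambda>f. \<chi> i. f i) \<in> PiM UNIV (\<lambda>_::'n::finite. borel) \<rightarrow>\<^sub>M (borel :: (real ^ 'n) measure)"
proof (subst borel_measurable_euclidean_space, intro ballI)
  fix b :: "real ^ 'n" assume "b \<in> Basis"
  then obtain i where "b = axis i 1" by (auto simp: Basis_vec_def)
  then show "(\<lambda>f. (\<chi> i. f i) \<bullet> b) \<in> borel_measurable (PiM UNIV (\<lambda>_::'n. borel))"
    by (simp add: inner_axis)
qed

lemma lborel_eq_distr_PiM:
  "lborel = distr (PiM UNIV (\<lambda>_::'n::finite. lborel)) borel (\<lambda>f. \<chi> i. (f i :: real))"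
proof (rule lborel_eqI)
  interpret product_sigma_finite "\<lambda>_::'n. lborel :: real measure"
    by (simp add: product_sigma_finite_def lborel.sigma_finite_measure_axioms)
  have meas: "(\<lambda>f. \<chi> i. f i) \<in> PiM UNIV (\<lambda>_::'n. lborel) \<rightarrow>\<^sub>M (borel :: (real ^ 'n) measure)"
    using measurable_vec_lambda by (simp cong: measurable_cong_sets sets_PiM_cong)
  fix l u :: "real ^ 'n" assume lu: "\<And>b. b \<in> Basis \<Longrightarrow> l \<bullet> b \<le> u \<bullet> b"
  have le: "l $ i \<le> u $ i" for i
    using lu[of "axis i 1"] by (simp add: inner_axis)
  have "emeasure (distr (PiM UNIV (\<lambda>_::'n. lborel)) borel (\<lambda>f. \<chi> i. (f i :: real))) (box l u)
      = emeasure (PiM UNIV (\<lambda>_::'n. lborel)) (PiE UNIV (\<lambda>i. {l $ i<..<u $ i}))"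
    by (subst emeasure_distr[OF meas])
      (auto simp: mem_box_cart space_PiM PiE_def Pi_def intro!: arg_cong2[where f=emeasure])
  also have "\<dots> = (\<Prod>i\<in>UNIV. ennreal (u $ i - l $ i))"
    using le by (subst emeasure_PiM) auto
  also have "\<dots> = ennreal (\<Prod>i\<in>UNIV. u $ i - l $ i)"
    using le by (intro prod_ennreal) (simp add: le)
  also have "(\<Prod>i\<in>UNIV. u $ i - l $ i) = (\<Prod>b\<in>Basis. (u - l) \<bullet> b)"
    by (subst prod.reindex_bij_betw[symmetric, where h="\<lambda>i. axis i 1" and S=UNIV])
      (auto simp: bij_betw_def inj_on_def axis_eq_axis Basis_vec_def inner_axis)
  finally show "emeasure (distr (PiM UNIV (\<lambda>_::'n. lborel)) borel (\<lambda>f. \<chi> i. (f i :: real))) (box l u)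
      = (\<Prod>b\<in>Basis. (u - l) \<bullet> b)" .
qed simp

text \<open>Each factor is bounded by a multiple of Lebesgue measure because its density is bounded by its value
  at the origin. So the product is at most a multiple of Lebesgue measure, and Lebesgue null sets can be
  neglected.\<close>

lemma nn_integral_PiM_le_lborel:
  fixes M :: "'i \<Rightarrow> real measure"
  assumes M: "\<And>i. has_quasi_concave_density_max_at_0 (M i)" and "finite I"
  shows "\<exists>c\<ge>0. \<forall>F\<in>borel_measurable (PiM I (\<lambda>_. borel)).
    (\<integral>\<^sup>+x. F x \<partial>PiM I M) \<le> ennreal c * (\<integral>\<^sup>+x. F x \<partial>PiM I (\<lambda>_. lborel))"
  using \<open>finite I\<close>
proof induction
  case empty
  then show ?case by (intro exI[of _ 1]) (simp add: PiM_empty)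
next
  case (insert i I)
  interpret M: product_sigma_finite M
    by (intro product_sigma_finite.intro sigma_finite_quasi_concave M)
  interpret L: product_sigma_finite "\<lambda>_::'i. lborel :: real measure"
    by (simp add: product_sigma_finite_def lborel.sigma_finite_measure_axioms)
  interpret LI: sigma_finite_measure "PiM I (\<lambda>_. lborel :: real measure)"
    by (rule L.sigma_finite) fact
  obtain c where c: "c \<ge> 0" "\<And>F. F \<in> borel_measurable (PiM I (\<lambda>_. borel)) \<Longrightarrow>
      (\<integral>\<^sup>+x. F x \<partial>PiM I M) \<le> ennreal c * (\<integral>\<^sup>+x. F x \<partial>PiM I (\<lambda>_. lborel))"
    using insert.IH by blast
  obtain \<phi> where \<phi>[measurable]: "\<phi> \<in> borel_measurable borel" and \<phi>0: "\<And>x. \<phi> x \<ge> 0" "\<And>x. \<phi> x \<le> \<phi> 0"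
    and Mi: "M i = density lborel (\<lambda>x. ennreal (\<phi> x))"
    using M[of i] unfolding has_quasi_concave_density_max_at_0_def by blast
  have sets_M: "sets (PiM J M) = sets (PiM J (\<lambda>_. borel))"
    and sets_L: "sets (PiM J (\<lambda>_. lborel)) = sets (PiM J (\<lambda>_. borel :: real measure))" for J
    by (auto intro!: sets_PiM_cong simp: sets_quasi_concave[OF M])
  show ?case
  proof (intro exI[of _ "\<phi> 0 * c"] conjI ballI)
    show "0 \<le> \<phi> 0 * c" using c \<phi>0 by simp
    fix F :: "('i \<Rightarrow> real) \<Rightarrow> ennreal" assume F: "F \<in> borel_measurable (PiM (insert i I) (\<lambda>_. borel))"
    then have FM: "F \<in> borel_measurable (PiM (insert i I) M)"
      and FL [measurable]: "F \<in> borel_measurable (PiM (insert i I) (\<lambda>_. lborel))"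
      by (simp_all add: measurable_cong_sets[OF sets_M refl] measurable_cong_sets[OF sets_L refl])
    have sec: "(\<lambda>x. F (x(i := s))) \<in> borel_measurable (PiM I (\<lambda>_. borel))" for s
      using F by measurable
    have [measurable]: "(\<lambda>s. \<integral>\<^sup>+x. F (x(i := s)) \<partial>PiM I (\<lambda>_. lborel)) \<in> borel_measurable lborel"
      by measurable
    have "(\<integral>\<^sup>+x. F x \<partial>PiM (insert i I) M) = (\<integral>\<^sup>+s. (\<integral>\<^sup>+x. F (x(i := s)) \<partial>PiM I M) \<partial>M i)"
      using insert.hyps FM by (intro M.product_nn_integral_insert_rev)
    also have "\<dots> \<le> (\<integral>\<^sup>+s. ennreal c * (\<integral>\<^sup>+x. F (x(i := s)) \<partial>PiM I (\<lambda>_. lborel)) \<partial>M i)"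
      by (intro nn_integral_mono c sec)
    also have "\<dots> = (\<integral>\<^sup>+s. ennreal (\<phi> s) * (ennreal c * (\<integral>\<^sup>+x. F (x(i := s)) \<partial>PiM I (\<lambda>_. lborel))) \<partial>lborel)"
      unfolding Mi by (subst nn_integral_density) auto
    also have "\<dots> \<le> (\<integral>\<^sup>+s. ennreal (\<phi> 0) * (ennreal c * (\<integral>\<^sup>+x. F (x(i := s)) \<partial>PiM I (\<lambda>_. lborel))) \<partial>lborel)"
      using \<phi>0 by (intro nn_integral_mono mult_right_mono ennreal_leI) auto
    also have "\<dots> = ennreal (\<phi> 0 * c) * (\<integral>\<^sup>+s. (\<integral>\<^sup>+x. F (x(i := s)) \<partial>PiM I (\<lambda>_. lborel)) \<partial>lborel)"
      using c \<phi>0 by (simp add: nn_integral_cmult ennreal_mult mult.assoc)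
    also have "\<dots> = ennreal (\<phi> 0 * c) * (\<integral>\<^sup>+x. F x \<partial>PiM (insert i I) (\<lambda>_. lborel))"
      using insert.hyps by (subst L.product_nn_integral_insert_rev) auto
    finally show "(\<integral>\<^sup>+x. F x \<partial>PiM (insert i I) M)
        \<le> ennreal (\<phi> 0 * c) * (\<integral>\<^sup>+x. F x \<partial>PiM (insert i I) (\<lambda>_. lborel))" .
  qed
qed

lemma measurable_vec_lambda_M:
  fixes M :: "'n::finite \<Rightarrow> real measure"
  assumes M: "\<And>i. has_quasi_concave_density_max_at_0 (M i)"
  shows "(\<lambda>f. \<chi> i. f i) \<in> PiM UNIV M \<rightarrow>\<^sub>M borel"
proof -
  have "sets (PiM UNIV M) = sets (PiM UNIV (\<lambda>_. borel))"
    by (auto intro!: sets_PiM_cong simp: sets_quasi_concave[OF M])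
  then show ?thesis
    using measurable_vec_lambda by (simp cong: measurable_cong_sets)
qed

lemma product_measure_absolutely_continuous:
  fixes M :: "'n::finite \<Rightarrow> real measure"
  assumes M: "\<And>i. has_quasi_concave_density_max_at_0 (M i)" and N: "N \<in> null_sets lborel"
  shows "N \<in> null_sets (distr (PiM UNIV M) borel (\<lambda>f. \<chi> i. f i))"
proof -
  note [measurable] = measurable_vec_lambda
  obtain c where c: "\<And>F. F \<in> borel_measurable (PiM UNIV (\<lambda>_. borel)) \<Longrightarrow>
      (\<integral>\<^sup>+x. F x \<partial>PiM UNIV M) \<le> ennreal c * (\<integral>\<^sup>+x. F x \<partial>PiM UNIV (\<lambda>_. lborel))"
    using nn_integral_PiM_le_lborel[of M UNIV, OF M finite] by blast
  have [measurable]: "N \<in> sets borel" using N by auto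
  have sets_L: "sets (PiM UNIV (\<lambda>_. lborel)) = sets (PiM UNIV (\<lambda>_::'n. borel :: real measure))"
    by (auto intro!: sets_PiM_cong)
  have "(\<lambda>f. \<chi> i. f i) \<in> PiM UNIV (\<lambda>_::'n. lborel) \<rightarrow>\<^sub>M (borel :: (real ^ 'n) measure)"
    using measurable_vec_lambda by (simp add: measurable_cong_sets[OF sets_L refl])
  then have "(\<integral>\<^sup>+f. indicator N (\<chi> i. f i) \<partial>PiM UNIV (\<lambda>_::'n. lborel))
      = (\<integral>\<^sup>+x. indicator N x \<partial>distr (PiM UNIV (\<lambda>_::'n. lborel)) borel (\<lambda>f. \<chi> i. f i))"
    by (subst nn_integral_distr) auto
  also have "\<dots> = (\<integral>\<^sup>+x. indicator N x \<partial>lborel)"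
    by (simp flip: lborel_eq_distr_PiM)
  also have "\<dots> = 0" using N by auto
  finally have "(\<integral>\<^sup>+f. indicator N (\<chi> i. f i) \<partial>PiM UNIV M) = 0"
    using c[of "\<lambda>f. indicator N (\<chi> i. f i)"] by simp
  then have "(\<integral>\<^sup>+x. indicator N x \<partial>distr (PiM UNIV M) borel (\<lambda>f. \<chi> i. f i)) = 0"
    using measurable_vec_lambda_M[OF M] by (subst nn_integral_distr) auto
  then show ?thesis by (auto simp: null_sets_def)
qed

lemma AE_product_measure:
  fixes M :: "'n::finite \<Rightarrow> real measure"
  assumes M: "\<And>i. has_quasi_concave_density_max_at_0 (M i)" and P: "AE x in lebesgue. P x"
  shows "AE x in distr (PiM UNIV M) borel (\<lambda>f. \<chi> i. f i). P x"
proof -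
  have "AE x in lborel. P x" using P by (simp add: AE_completion_iff)
  then obtain N where "{x. \<not> P x} \<subseteq> N" "N \<in> null_sets lborel"
    by (auto simp: eventually_ae_filter)
  then show ?thesis
    using product_measure_absolutely_continuous[of M, OF M] by (auto simp: eventually_ae_filter)
qed

section \<open>Borel approximation of Lebesgue measurable functions\<close>

definition zero_out :: "'n set \<Rightarrow> real ^ 'n \<Rightarrow> real ^ 'n" where
  "zero_out J x = (\<chi> i. if i \<in> J then 0 else x $ i)"

lemma zero_out_zero_out: "zero_out J (zero_out K x) = zero_out (J \<union> K) x"
  by (simp add: zero_out_def vec_eq_iff)

lemma zero_out_empty [simp]: "zero_out {} x = x"
  by (simp add: zero_out_def vec_eq_iff)

lemma continuous_on_zero_out: "continuous_on S (zero_out J)"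
proof -
  have "continuous_on S (\<lambda>x. if i \<in> J then 0 else x $ i)" for i
    by (cases "i \<in> J") (auto intro!: continuous_intros)
  then show ?thesis unfolding zero_out_def by (intro continuous_on_vec_lambda)
qed

text \<open>Coordinate subspaces are null sets, so an arbitrary Borel kernel of \<open>S\<close> may lose the projections of
  its own points. A \<open>\<sigma>\<close>-compact kernel can be saturated: it has finitely many coordinate projections,
  each again \<open>\<sigma>\<close>-compact and contained in \<open>S\<close>.\<close>

lemma borel_kernel_closed_under_zero_out:
  fixes S :: "(real ^ 'n::finite) set"
  assumes S: "S \<in> sets lebesgue" and closed: "\<And>x J. x \<in> S \<Longrightarrow> zero_out J x \<in> S"
  obtains D where "D \<in> sets borel" "D \<subseteq> S" "S - D \<in> null_sets lebesgue"
    "\<And>x J. x \<in> D \<Longrightarrow> zero_out J x \<in> D"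
proof -
  obtain C T where CT: "fsigma C" "T \<in> null_sets lebesgue" "C \<union> T = S" "disjnt C T"
    using lebesgue_set_almost_fsigma[OF S] .
  obtain K :: "nat \<Rightarrow> (real ^ 'n) set" where K: "range K \<subseteq> Collect compact" "C = \<Union>(K ` UNIV)"
    using CT(1) fsigma_Union_compact by metis
  define D where "D = (\<Union>J. zero_out J ` C)"
  have "C \<subseteq> D" unfolding D_def by (force intro: exI[of _ "{}"])
  show thesis
  proof (rule that)
    have "D = (\<Union>J. \<Union>n. zero_out J ` K n)" by (auto simp: D_def K(2))
    moreover have "zero_out J ` K n \<in> sets borel" for J n
      using K(1) by (intro borel_compact compact_continuous_image continuous_on_zero_out) auto
    ultimately show "D \<in> sets borel" by (auto intro!: sets.countable_UN' countable_finite)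
    show "D \<subseteq> S" using CT(3) closed by (auto simp: D_def)
    have "S - D = T - D" using \<open>C \<subseteq> D\<close> CT(3) by auto
    moreover have "S - D \<in> sets lebesgue" using S \<open>D \<in> sets borel\<close> by auto
    ultimately show "S - D \<in> null_sets lebesgue"
      using CT(2) null_sets_subset by (metis Diff_subset)
    show "zero_out J x \<in> D" if "x \<in> D" for x J
      using that unfolding D_def by (force simp: zero_out_zero_out)
  qed
qed

text \<open>Sections of a Lebesgue measurable function need not be measurable, and here the sections through
  the coordinate subspaces matter. The minorant is assembled from kernels of the superlevel sets at
  rational heights that are closed under projection, so that it inherits monotonicity everywhere while
  it differs from \<open>F\<close> only on a countable union of null sets.\<close>

lemma borel_minorant_increasing_under_zero_out:
  fixes F :: "real ^ 'n::finite \<Rightarrow> ennreal"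
  assumes [measurable]: "F \<in> borel_measurable lebesgue" and inc: "\<And>x J. F x \<le> F (zero_out J x)"
  obtains F' where "F' \<in> borel_measurable borel" "\<And>x. F' x \<le> F x" "AE x in lebesgue. F' x = F x"
    "\<And>x J. F' x \<le> F' (zero_out J x)"
proof -
  define S where "S q = {x. ennreal (real_of_rat q) \<le> F x}" for q
  have "\<exists>D. D \<in> sets borel \<and> D \<subseteq> S q \<and> S q - D \<in> null_sets lebesgue \<and>
    (\<forall>x J. x \<in> D \<longrightarrow> zero_out J x \<in> D)" for q
  proof -
    have "{x \<in> space lebesgue. ennreal (real_of_rat q) \<le> F x} \<in> sets lebesgue" by measurable
    then have "S q \<in> sets lebesgue" by (simp add: S_def)
    moreover have "zero_out J x \<in> S q" if "x \<in> S q" for x J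
      using that inc order_trans unfolding S_def by blast
    ultimately show ?thesis by (rule borel_kernel_closed_under_zero_out) blast+
  qed
  then obtain D where D [measurable]: "\<And>q. D q \<in> sets borel" and D': "\<And>q. D q \<subseteq> S q"
    "\<And>q. S q - D q \<in> null_sets lebesgue" "\<And>q x J. x \<in> D q \<Longrightarrow> zero_out J x \<in> D q"
    by metis
  define F' where "F' x = (SUP q. ennreal (real_of_rat q) * indicator (D q) x)" for x
  have le: "F' x \<le> F x" for x
    unfolding F'_def using D'(1) by (intro SUP_least) (auto simp: S_def split: split_indicator)
  show thesis
  proof (rule that)
    show "F' \<in> borel_measurable borel" unfolding F'_def by measurable
    show "F' x \<le> F x" for x by (rule le)
    show "F' x \<le> F' (zero_out J x)" for x J
      unfolding F'_def using D'(3) by (intro SUP_mono') (auto split: split_indicator)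
    have "AE x in lebesgue. \<forall>q. x \<notin> S q - D q"
      using D'(2) by (subst AE_all_countable) (blast intro: AE_not_in)
    then show "AE x in lebesgue. F' x = F x"
    proof eventually_elim
      case (elim x)
      have "F x \<le> F' x"
      proof (rule ccontr)
        assume "\<not> F x \<le> F' x"
        then obtain q where q: "F' x < ennreal (real_of_rat q)" "ennreal (real_of_rat q) < F x"
          using ennreal_rat_dense by (meson not_le)
        then have "x \<in> D q" using elim by (auto simp: S_def)
        then have "ennreal (real_of_rat q) \<le> F' x"
          unfolding F'_def by (intro SUP_upper2[of q]) auto
        with q show False by simp
      qed
      with le show ?case by (simp add: antisym)
    qed
  qed
qed

text \<open>Approximating \<open>H\<close> from above at every point, like \<open>F\<close> and \<open>G\<close> from below, keeps the
  pointwise hypothesis of the Prekopa-Leindler inequality intact.\<close>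

lemma borel_majorant:
  fixes H :: "real ^ 'n::finite \<Rightarrow> ennreal"
  assumes "H \<in> borel_measurable lebesgue"
  obtains H' where "H' \<in> borel_measurable borel" "\<And>x. H x \<le> H' x" "AE x in lebesgue. H' x = H x"
proof -
  obtain H1 where H1 [measurable]: "H1 \<in> borel_measurable lborel" and "AE x in lborel. H x = H1 x"
    using completion_ex_borel_measurable[OF assms] by blast
  then obtain N where N: "{x. H x \<noteq> H1 x} \<subseteq> N" "N \<in> null_sets lborel"
    by (auto simp: eventually_ae_filter)
  then have [measurable]: "N \<in> sets borel" by auto
  have ae: "AE x in lborel. x \<notin> N" using N(2) by (rule AE_not_in)
  show thesis
  proof (rule that[of "\<lambda>x. if x \<in> N then top else H1 x"])
    show "(\<lambda>x. if x \<in> N then top else H1 x) \<in> borel_measurable borel"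
      using H1 by measurable
    have eq: "H x = H1 x" if "x \<notin> N" for x
      using N(1) that by blast
    show "H x \<le> (if x \<in> N then top else H1 x)" for x
      by (simp add: eq)
    have "AE x in lborel. (if x \<in> N then top else H1 x) = H x"
      using ae by eventually_elim (simp add: eq)
    then show "AE x in lebesgue. (if x \<in> N then top else H1 x) = H x"
      by (rule AE_completion)
  qed
qed

section \<open>The inequality for weakly unconditional functions\<close>

lemma nn_integral_product_measure:
  fixes M :: "'n::finite \<Rightarrow> real measure"
  assumes M: "\<And>i. has_quasi_concave_density_max_at_0 (M i)"
    and "F' \<in> borel_measurable borel" and ae: "AE x in lebesgue. F' x = F x"
  shows "(\<integral>\<^sup>+x. F x \<partial>product_measure M) = (\<integral>\<^sup>+f. F' (\<chi> i. f i) \<partial>PiM UNIV M)"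
proof -
  have "(\<integral>\<^sup>+x. F x \<partial>product_measure M) = (\<integral>\<^sup>+x. F x \<partial>distr (PiM UNIV M) borel (\<lambda>f. \<chi> i. f i))"
    by (simp add: product_measure_def nn_integral_completion)
  also have "\<dots> = (\<integral>\<^sup>+x. F' x \<partial>distr (PiM UNIV M) borel (\<lambda>f. \<chi> i. f i))"
    using AE_product_measure[of M, OF M ae] by (intro nn_integral_cong_AE) auto
  also have "\<dots> = (\<integral>\<^sup>+f. F' (\<chi> i. f i) \<partial>PiM UNIV M)"
    using assms(2) measurable_vec_lambda_M[of M, OF M] by (subst nn_integral_distr) auto
  finally show ?thesis .
qed

theorem prekopa_leindler_product_measure:
  fixes M :: "'n::finite \<Rightarrow> real measure" and F G H :: "real ^ 'n \<Rightarrow> ennreal"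
  assumes M: "\<And>i. has_quasi_concave_density_max_at_0 (M i)"
    and l: "0 < l" "l < 1" and \<alpha>\<beta>: "0 < \<alpha>" "0 < \<beta>" "(1 - l) * \<alpha> + l * \<beta> \<le> 1"
    and F: "F \<in> borel_measurable lebesgue" and G: "G \<in> borel_measurable lebesgue"
    and H: "H \<in> borel_measurable lebesgue"
    and incF: "\<And>x J. F x \<le> F (zero_out J x)" and incG: "\<And>x J. G x \<le> G (zero_out J x)"
    and FGH: "\<And>x y. ennpowr (F x) (1 - l) * ennpowr (G y) l
      \<le> H (((1 - l) * \<alpha>) *\<^sub>R x + (l * \<beta>) *\<^sub>R y)"
  shows "ennreal ((\<alpha> powr (1 - l) * \<beta> powr l) ^ CARD('n))
      * (ennpowr (\<integral>\<^sup>+x. F x \<partial>product_measure M) (1 - l) * ennpowr (\<integral>\<^sup>+x. G x \<partial>product_measure M) l)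
    \<le> (\<integral>\<^sup>+x. H x \<partial>product_measure M)"
proof -
  obtain F' where F': "F' \<in> borel_measurable borel" "\<And>x. F' x \<le> F x" "AE x in lebesgue. F' x = F x"
    "\<And>x J. F' x \<le> F' (zero_out J x)"
    using borel_minorant_increasing_under_zero_out[OF F incF] by blast
  obtain G' where G': "G' \<in> borel_measurable borel" "\<And>x. G' x \<le> G x" "AE x in lebesgue. G' x = G x"
    "\<And>x J. G' x \<le> G' (zero_out J x)"
    using borel_minorant_increasing_under_zero_out[OF G incG] by blast
  obtain H' where H': "H' \<in> borel_measurable borel" "\<And>x. H x \<le> H' x" "AE x in lebesgue. H' x = H x"
    using borel_majorant[OF H] by blast
  have meas: "(\<lambda>f. K (\<chi> i. f i)) \<in> borel_measurable (PiM UNIV M)" if "K \<in> borel_measurable borel"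
    for K :: "real ^ 'n \<Rightarrow> ennreal"
    using measurable_compose[OF measurable_vec_lambda_M[of M, OF M] that] .
  have upd: "(\<chi> j. (x(i := 0)) j) = zero_out {i} (\<chi> j. x j)" for x and i :: 'n
    by (simp add: zero_out_def vec_eq_iff)
  have "ennreal ((\<alpha> powr (1 - l) * \<beta> powr l) ^ CARD('n))
      * (ennpowr (\<integral>\<^sup>+f. F' (\<chi> i. f i) \<partial>PiM UNIV M) (1 - l)
        * ennpowr (\<integral>\<^sup>+f. G' (\<chi> i. f i) \<partial>PiM UNIV M) l)
    \<le> (\<integral>\<^sup>+f. H' (\<chi> i. f i) \<partial>PiM UNIV M)"
  proof (rule prekopa_leindler_PiM[OF M l \<alpha>\<beta> finite])
    show "F' (\<chi> j. x j) \<le> F' (\<chi> j. (x(i := 0)) j)" "G' (\<chi> j. x j) \<le> G' (\<chi> j. (x(i := 0)) j)"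
      for x and i :: 'n
      by (simp_all only: upd F'(4) G'(4))
    fix x y :: "'n \<Rightarrow> real"
    have "ennpowr (F' (\<chi> i. x i)) (1 - l) * ennpowr (G' (\<chi> i. y i)) l
        \<le> ennpowr (F (\<chi> i. x i)) (1 - l) * ennpowr (G (\<chi> i. y i)) l"
      using l by (intro mult_mono ennpowr_mono F'(2) G'(2)) auto
    also have "\<dots> \<le> H' (((1 - l) * \<alpha>) *\<^sub>R (\<chi> i. x i) + (l * \<beta>) *\<^sub>R (\<chi> i. y i))"
      using FGH H'(2) by (rule order_trans)
    also have "((1 - l) * \<alpha>) *\<^sub>R (\<chi> i. x i) + (l * \<beta>) *\<^sub>R (\<chi> i. y i)
        = (\<chi> i. (\<lambda>i\<in>UNIV. (1 - l) * \<alpha> * x i + l * \<beta> * y i) i)"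
      by (simp add: vec_eq_iff)
    finally show "ennpowr (F' (\<chi> i. x i)) (1 - l) * ennpowr (G' (\<chi> i. y i)) l
        \<le> H' (\<chi> i. (\<lambda>i\<in>UNIV. (1 - l) * \<alpha> * x i + l * \<beta> * y i) i)" .
  qed (intro meas F' G' H')+
  then show ?thesis
    by (simp only: nn_integral_product_measure[OF M F'(1,3)] nn_integral_product_measure[OF M G'(1,3)]
        nn_integral_product_measure[OF M H'(1,3)])
qed

lemma weakly_unconditional_zero_out:
  assumes "weakly_unconditional f"
  shows "f x \<le> f (zero_out J x)"
proof -
  have "f x \<le> f (\<chi> i. (if i \<in> J then 0 else 1) * x $ i)"
    using assms unfolding weakly_unconditional_def by auto
  also have "(\<chi> i. (if i \<in> J then 0 else 1) * x $ i) = zero_out J x"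
    by (simp add: zero_out_def vec_eq_iff)
  finally show ?thesis .
qed

text \<open>The bound \<open>1\<close> makes every convex set that contains the origin closed under the combination in
  the hypothesis of the theorem. It is Hoelder's inequality with exponents \<open>p\<close> and \<open>p / (p - 1)\<close> for the vectors
  \<open>((1 - t)\<^bsup>1/p\<^esup>, t\<^bsup>1/p\<^esup>)\<close> and \<open>((1 - l)\<^bsup>(p-1)/p\<^esup>, l\<^bsup>(p-1)/p\<^esup>)\<close>.\<close>

lemma holder_coefficients_le_1:
  fixes p t l :: real
  assumes "p > 1" "0 < t" "t < 1" "0 < l" "l < 1"
  shows "(1 - t) powr (1 / p) * (1 - l) powr ((p - 1) / p) + t powr (1 / p) * l powr ((p - 1) / p) \<le> 1"
proof -
  have p: "1 / p + (p - 1) / p = 1" using assms by (simp add: field_simps)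
  have "(1 - t) powr (1 / p) * (1 - l) powr ((p - 1) / p) \<le> 1 / p * (1 - t) + (p - 1) / p * (1 - l)"
    "t powr (1 / p) * l powr ((p - 1) / p) \<le> 1 / p * t + (p - 1) / p * l"
    using assms p by (intro Youngs_inequality_0; simp)+
  moreover have "c * (1 - t) + d * (1 - l) + (c * t + d * l) = c + d" for c d
    by (simp add: algebra_simps)
  note this[of "1 / p" "(p - 1) / p"]
  ultimately show ?thesis using p by linarith
qed

theorem theorem2p6:
  fixes p t :: real
    and M :: "'n::finite \<Rightarrow> real measure"
    and f g h :: "real ^ 'n \<Rightarrow> real"
  assumes "p > 1"
    and "t \<in> {0..1}"
    and "\<And>i. has_quasi_concave_density_max_at_0 (M i)"
    and "f \<in> borel_measurable lebesgue" "g \<in> borel_measurable lebesgue"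
        "h \<in> borel_measurable lebesgue"
    and "\<And>x. f x \<ge> 0" "\<And>x. g x \<ge> 0" "\<And>x. h x \<ge> 0"
    and "weakly_unconditional f" "weakly_unconditional g"
    and "positively_decreasing f" "positively_decreasing g"
    and "\<And>x y l. x \<in> fun_supp f \<Longrightarrow> y \<in> fun_supp g \<Longrightarrow> 0 < l \<Longrightarrow> l < 1 \<Longrightarrow>
           h (((1 - t) powr (1 / p) * (1 - l) powr ((p - 1) / p)) *\<^sub>R x
              + (t powr (1 / p) * l powr ((p - 1) / p)) *\<^sub>R y)
           \<ge> f x powr ((1 - t) powr (1 / p) * (1 - l) powr ((p - 1) / p))
             * g y powr (t powr (1 / p) * l powr ((p - 1) / p))"
  shows "(\<integral>\<^sup>+ x. ennreal (h x) \<partial>product_measure M) \<ge>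
    (SUP l\<in>{0<..<1}.
       ennreal ((((1 - t) / (1 - l)) powr (1 - l) * (t / l) powr l) powr (real CARD('n) / p))
       * ennpowr (\<integral>\<^sup>+ x. ennreal (f x powr (((1 - t) / (1 - l)) powr (1 / p))) \<partial>product_measure M) (1 - l)
       * ennpowr (\<integral>\<^sup>+ x. ennreal (g x powr ((t / l) powr (1 / p))) \<partial>product_measure M) l)"
proof (rule SUP_least)
  fix l :: real assume "l \<in> {0<..<1}"
  then have l: "0 < l" "l < 1" by auto
  show "ennreal ((((1 - t) / (1 - l)) powr (1 - l) * (t / l) powr l) powr (real CARD('n) / p))
       * ennpowr (\<integral>\<^sup>+ x. ennreal (f x powr (((1 - t) / (1 - l)) powr (1 / p))) \<partial>product_measure M) (1 - l)
       * ennpowr (\<integral>\<^sup>+ x. ennreal (g x powr ((t / l) powr (1 / p))) \<partial>product_measure M) l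
     \<le> (\<integral>\<^sup>+ x. ennreal (h x) \<partial>product_measure M)"
  proof (cases "t = 0 \<or> t = 1")
    case True
    \<comment> \<open>the leading constant vanishes\<close>
    then show ?thesis by auto
  next
    case False
    then have t: "0 < t" "t < 1" using assms(2) by auto
    \<comment> \<open>With these scalings the coefficients of the hypothesis are \<open>(1 - l) \<alpha>\<close> and \<open>l \<beta>\<close>, so that
      \<open>f\<^sup>\<alpha>\<close>, \<open>g\<^sup>\<beta>\<close> and \<open>h\<close> satisfy a Prekopa-Leindler condition with weights \<open>1 - l\<close> and \<open>l\<close>.\<close>
    define \<alpha> \<beta> where "\<alpha> = ((1 - t) / (1 - l)) powr (1 / p)" and "\<beta> = (t / l) powr (1 / p)"
    have pos: "\<alpha> > 0" "\<beta> > 0" using l t by (simp_all add: \<alpha>_def \<beta>_def)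
    have "x * (y / x) powr (1 / p) = y powr (1 / p) * x powr ((p - 1) / p)" if "x > 0" "y > 0" for x y :: real
    proof -
      have "x = x powr (1 / p + (p - 1) / p)"
        using that \<open>p > 1\<close> by (simp add: field_simps)
      then have "x = x powr (1 / p) * x powr ((p - 1) / p)"
        by (simp only: powr_add)
      then show ?thesis using that by (simp add: powr_divide field_simps)
    qed
    then have coeff: "(1 - l) * \<alpha> = (1 - t) powr (1 / p) * (1 - l) powr ((p - 1) / p)"
      "l * \<beta> = t powr (1 / p) * l powr ((p - 1) / p)"
      using l t by (simp_all add: \<alpha>_def \<beta>_def)
    have const: "(((1 - t) / (1 - l)) powr (1 - l) * (t / l) powr l) powr (real CARD('n) / p)
        = (\<alpha> powr (1 - l) * \<beta> powr l) ^ CARD('n)"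
    proof -
      have "\<alpha> powr (1 - l) * \<beta> powr l = (((1 - t) / (1 - l)) powr (1 - l) * (t / l) powr l) powr (1 / p)"
        using l t by (simp add: \<alpha>_def \<beta>_def powr_powr powr_mult mult.commute)
      then show ?thesis
        using l t by (simp add: powr_powr flip: powr_realpow)
    qed
    have "ennreal ((\<alpha> powr (1 - l) * \<beta> powr l) ^ CARD('n))
      * (ennpowr (\<integral>\<^sup>+x. ennreal (f x powr \<alpha>) \<partial>product_measure M) (1 - l)
        * ennpowr (\<integral>\<^sup>+x. ennreal (g x powr \<beta>) \<partial>product_measure M) l)
      \<le> (\<integral>\<^sup>+x. ennreal (h x) \<partial>product_measure M)"
    proof (rule prekopa_leindler_product_measure[OF assms(3) l pos])
      show "(1 - l) * \<alpha> + l * \<beta> \<le> 1"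
        unfolding coeff using holder_coefficients_le_1 assms(1) t l by blast
      show "ennreal (f x powr \<alpha>) \<le> ennreal (f (zero_out J x) powr \<alpha>)"
        "ennreal (g x powr \<beta>) \<le> ennreal (g (zero_out J x) powr \<beta>)" for x J
        using pos assms(7,8) weakly_unconditional_zero_out[OF assms(10)]
          weakly_unconditional_zero_out[OF assms(11)]
        by (intro ennreal_leI powr_mono2; simp)+
      show "ennpowr (ennreal (f x powr \<alpha>)) (1 - l) * ennpowr (ennreal (g y powr \<beta>)) l
          \<le> ennreal (h (((1 - l) * \<alpha>) *\<^sub>R x + (l * \<beta>) *\<^sub>R y))" for x y
      proof (cases "f x = 0 \<or> g y = 0")
        case False
        then have "x \<in> fun_supp f" "y \<in> fun_supp g"
          using assms(7)[of x] assms(8)[of y] by (auto simp: fun_supp_def)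
        from assms(14)[OF this l] show ?thesis
          by (simp add: ennpowr_ennreal powr_powr mult.commute ennreal_leI flip: coeff ennreal_mult)
      qed auto
    qed (use assms(4-6) in measurable)
    then show ?thesis
      by (simp add: const \<alpha>_def[symmetric] \<beta>_def[symmetric] mult.assoc)
  qed
qed

end
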